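(* Let $m\ge 0$ be an integer and let $G$ be a graph on $n$ vertices with $n\ge 3m^2+4m$. Let $c$ be an edge coloring of $G$ with total color degree $\hat d(G)\ge 2mn$. Then $G$ contains a rainbow matching (with respect to $c$) of size $m$.
   Context: All graphs are finite and simple. An edge coloring of $G$ is any assignment $c:E(G)\to[r]$ of colors to edges (not necessarily proper). For a vertex $v$, the color degree $\hat d(v)$ is the number of distinct colors that $c$ assigns to edges incident to $v$. The total color degree of $G$ is $\hat d(G)=\sum_{v\in V(G)}\hat d(v)$. A matching of size $k$ is a set of $k$ pairwise vertex-disjoint edges; it is rainbow if its edges receive pairwise distinct colors. *)

theory Defs
  imports Main
begin

definition finite_simple_graph :: "'a set \<Rightarrow> 'a set set \<Rightarrow> bool" where
  "finite_simple_graph V E \<longleftrightarrow> finite V \<and> (\<forall>e\<in>E. e \<subseteq> V \<and> card e = 2)"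

(* Not necessarily proper and not necessarily using all r colors. The values of c outside E
   are arbitrary; no definition below looks at them. *)
definition edge_coloring :: "'a set set \<Rightarrow> nat \<Rightarrow> ('a set \<Rightarrow> nat) \<Rightarrow> bool" where
  "edge_coloring E r c \<longleftrightarrow> (\<forall>e\<in>E. c e \<in> {1..r})"

definition color_degree :: "'a set set \<Rightarrow> ('a set \<Rightarrow> nat) \<Rightarrow> 'a \<Rightarrow> nat" where
  "color_degree E c v = card (c ` {e \<in> E. v \<in> e})"

definition total_color_degree :: "'a set \<Rightarrow> 'a set set \<Rightarrow> ('a set \<Rightarrow> nat) \<Rightarrow> nat" where
  "total_color_degree V E c = (\<Sum>v\<in>V. color_degree E c v)"

definition matching :: "'a set set \<Rightarrow> 'a set set \<Rightarrow> bool" where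
  "matching E M \<longleftrightarrow> M \<subseteq> E \<and> pairwise disjnt M"

definition rainbow :: "('a set \<Rightarrow> nat) \<Rightarrow> 'a set set \<Rightarrow> bool" where
  "rainbow c M \<longleftrightarrow> inj_on c M"

end

(* Induct on m. If some vertex v has color degree greater than 3m, delete it, take a rainbow
   matching of size m in the rest, and add an edge at v: at most m colors and 2m endpoints are
   forbidden. Otherwise all color degrees are at most 3m. Let M be a rainbow matching of size m
   that is not extendable to size m + 1 even after exchanging one edge for two. A vertex outside M
   then sees, besides the m colors of M, only new colors on edges towards M; and by the exchange
   property, for each edge of M at most two outside vertices see two new colors on it. So the
   outside vertices contribute at most 2mn + 2m to the total, and the 2m covered ones at most 6m^2,
   which is less than 2(m + 1)n in total. *)
theory Submission
  imports Defs
begin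

section \<open>Graphs and rainbow matchings\<close>

lemma finite_simple_graph_finite_edges:
  assumes "finite_simple_graph V E"
  shows "finite E"
  using assms unfolding finite_simple_graph_def
  by (meson PowI finite_Pow_iff finite_subset subsetI)

lemma finite_simple_graph_edge_at:
  assumes "finite_simple_graph V E" "e \<in> E" "v \<in> e"
  obtains u where "e = {v, u}" "u \<noteq> v" "u \<in> V"
proof -
  have "card e = 2" "e \<subseteq> V"
    using assms unfolding finite_simple_graph_def by auto
  then obtain x y where "e = {x, y}" "x \<noteq> y"
    by (meson card_2_iff)
  with \<open>e \<subseteq> V\<close> \<open>v \<in> e\<close> that show thesis
    by (auto simp: insert_commute)
qed

lemma rainbow_matching_insert:
  assumes "matching E M" "rainbow c M" "finite M"
    and "e \<in> E" "e \<inter> \<Union>M = {}" "c e \<notin> c ` M"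
  shows "matching E (insert e M)" "rainbow c (insert e M)" "card (insert e M) = Suc (card M)"
proof -
  have "disjnt e f" "disjnt f e" if "f \<in> M" for f
    using that assms(5) by (auto simp: disjnt_def)
  then show "matching E (insert e M)"
    using assms(1,4) by (auto simp: matching_def pairwise_insert)
  show "rainbow c (insert e M)"
    using assms(2,6) by (auto simp: rainbow_def)
  show "card (insert e M) = Suc (card M)"
    using assms(3,6) by (intro card_insert_disjoint) auto
qed

lemma matching_remove:
  "matching E M \<Longrightarrow> matching E (M - {e})"
  by (auto simp: matching_def pairwise_def)

lemma rainbow_remove:
  "rainbow c M \<Longrightarrow> rainbow c (M - {e})"
  by (auto simp: rainbow_def inj_on_def)

lemma card_Union_matching:
  assumes "finite_simple_graph V E" "matching E M"
  shows "card (\<Union>M) = 2 * card M"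
proof -
  have E: "\<And>e. e \<in> M \<Longrightarrow> card e = 2" "pairwise disjnt M"
    using assms by (auto simp: finite_simple_graph_def matching_def)
  have "card (\<Union>M) = sum card M"
    using E by (intro card_Union_disjoint) (auto intro: card_ge_0_finite)
  also have "\<dots> = 2 * card M"
    using E by simp
  finally show ?thesis .
qed

section \<open>Color degrees, and splitting off a vertex of large color degree\<close>

lemma color_degree_less_card:
  assumes "finite_simple_graph V E" "v \<in> V"
  shows "color_degree E c v < card V"
proof -
  have fin: "finite V"
    using assms by (simp add: finite_simple_graph_def)
  have "c ` {e \<in> E. v \<in> e} \<subseteq> (\<lambda>u. c {v, u}) ` (V - {v})"
    by (auto elim!: finite_simple_graph_edge_at[OF assms(1)])
  then have "color_degree E c v \<le> card (V - {v})"
    unfolding color_degree_def using fin by (meson finite_Diff surj_card_le)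
  with fin assms(2) show ?thesis
    by (metis card_Diff1_less order.strict_trans1)
qed

lemma color_degree_delete_vertex:
  assumes "finite_simple_graph V E" "u \<noteq> v"
  shows "color_degree E c u \<le> Suc (color_degree {e \<in> E. v \<notin> e} c u)"
proof -
  let ?E' = "{e \<in> E. v \<notin> e}"
  have "e = {u, v}" if "e \<in> E" "u \<in> e" "v \<in> e" for e
    using that assms by (auto elim!: finite_simple_graph_edge_at[OF assms(1)])
  then have "c ` {e \<in> E. u \<in> e} \<subseteq> insert (c {u, v}) (c ` {e \<in> ?E'. u \<in> e})"
    by auto
  moreover have "finite (c ` {e \<in> ?E'. u \<in> e})"
    using finite_simple_graph_finite_edges[OF assms(1)] by simp
  ultimately have "card (c ` {e \<in> E. u \<in> e}) \<le> card (insert (c {u, v}) (c ` {e \<in> ?E'. u \<in> e}))"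
    by (intro card_mono) auto
  also have "\<dots> \<le> Suc (card (c ` {e \<in> ?E'. u \<in> e}))"
    by (cases "finite (c ` {e \<in> ?E'. u \<in> e})") (simp_all add: card_insert_if)
  finally show ?thesis
    unfolding color_degree_def .
qed

text \<open>The deletion costs at most one color at each of the other \<open>card V - 1\<close>
  vertices, namely that of the edge to \<open>v\<close>, plus the color degree of \<open>v\<close>
  itself, again at most \<open>card V - 1\<close>.\<close>

lemma total_color_degree_delete_vertex:
  assumes "finite_simple_graph V E" "v \<in> V"
  shows "total_color_degree V E c
    \<le> total_color_degree (V - {v}) {e \<in> E. v \<notin> e} c + 2 * (card V - 1)"
proof -
  let ?E' = "{e \<in> E. v \<notin> e}"
  have fin: "finite V"
    using assms by (simp add: finite_simple_graph_def)
  have "total_color_degree V E c = color_degree E c v + (\<Sum>u\<in>V - {v}. color_degree E c u)"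
    using fin assms(2) by (simp add: total_color_degree_def sum.remove)
  also have "(\<Sum>u\<in>V - {v}. color_degree E c u) \<le> (\<Sum>u\<in>V - {v}. color_degree ?E' c u + 1)"
    using color_degree_delete_vertex[OF assms(1)] by (intro sum_mono) auto
  also have "\<dots> = total_color_degree (V - {v}) ?E' c + (card V - 1)"
    using fin assms(2) unfolding total_color_degree_def by (subst sum.distrib) simp
  finally show ?thesis
    using color_degree_less_card[OF assms, of c] by linarith
qed

lemma rainbow_matching_extend_at_vertex:
  assumes "finite_simple_graph V E"
    and M: "matching {e \<in> E. v \<notin> e} M" "rainbow c M"
    and "color_degree E c v > 3 * card M"
  shows "\<exists>M'. matching E M' \<and> rainbow c M' \<and> card M' = Suc (card M)"
proof -
  have ME: "M \<subseteq> E" and v: "v \<notin> \<Union>M" and M': "matching E M"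
    using M(1) by (auto simp: matching_def)
  have finM: "finite M"
    using ME finite_simple_graph_finite_edges[OF assms(1)] finite_subset by blast
  have finU: "finite (\<Union>M)"
    using assms(1) ME by (auto simp: finite_simple_graph_def intro!: finite_subset[of "\<Union>M" V])
  \<comment> \<open>The forbidden colors. Endpoints in \<open>\<Union>M\<close> are excluded through
    the colors of the pairs \<open>{v, z}\<close>; pairs that are not edges can only enlarge
    \<open>?B\<close>.\<close>
  let ?B = "c ` M \<union> (\<lambda>z. c {v, z}) ` \<Union>M"
  have "card ?B \<le> card (c ` M) + card ((\<lambda>z. c {v, z}) ` \<Union>M)"
    by (rule card_Un_le)
  also have "\<dots> \<le> card M + card (\<Union>M)"
    by (intro add_mono card_image_le finM finU)
  finally have "card ?B \<le> 3 * card M"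
    by (simp add: card_Union_matching[OF assms(1) M'])
  then have "\<not> c ` {e \<in> E. v \<in> e} \<subseteq> ?B"
    using assms(4) finM finU card_mono[of ?B "c ` {e \<in> E. v \<in> e}"]
    by (auto simp: color_degree_def)
  then obtain e where e: "e \<in> E" "v \<in> e" "c e \<notin> ?B"
    by blast
  obtain u where u: "e = {v, u}"
    using finite_simple_graph_edge_at[OF assms(1) e(1,2)] .
  have "e \<inter> \<Union>M = {}"
    \<comment> \<open>If \<open>u\<close> were covered by \<open>M\<close>, then
      \<open>c e = c {v, u}\<close> would lie in \<open>?B\<close>.\<close>
    using u v e(3) by auto
  with rainbow_matching_insert[OF M' M(2) finM e(1)] e(3) show ?thesis
    by blast
qed

section \<open>Consequences of non-extendability: exchange and counting\<close>

text \<open>Otherwise the edge \<open>{x, y}\<close> of \<open>M\<close> could be exchanged for \<open>{u, x}\<close> and \<open>{w, y}\<close>.\<close>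

lemma rainbow_matching_exchange:
  assumes "finite_simple_graph V E" "matching E M" "rainbow c M"
    and max: "\<nexists>M'. matching E M' \<and> rainbow c M' \<and> card M' = Suc (card M)"
    and xy: "{x, y} \<in> M"
    and "u \<notin> \<Union>M" "w \<notin> \<Union>M" "u \<noteq> w"
    and "{u, x} \<in> E" "{w, y} \<in> E" "c {u, x} \<notin> c ` M" "c {w, y} \<notin> c ` M"
  shows "c {u, x} = c {w, y}"
proof (rule ccontr)
  assume neq: "c {u, x} \<noteq> c {w, y}"
  have finM: "finite M"
    using assms(2) finite_simple_graph_finite_edges[OF assms(1)]
    by (auto simp: matching_def intro: finite_subset)
  have "card {x, y} = 2"
    using assms(1,2) xy by (auto simp: finite_simple_graph_def matching_def)
  then have "x \<noteq> y"
    by auto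
  let ?N = "M - {{x, y}}"
  have "disjnt {x, y} f" if "f \<in> ?N" for f
    using that assms(2) xy pairwiseD[of disjnt M "{x, y}" f] unfolding matching_def by blast
  then have x: "x \<notin> \<Union>?N" and y: "y \<notin> \<Union>?N"
    by (auto simp: disjnt_def)
  have N: "matching E ?N" "rainbow c ?N" "finite ?N"
    using assms(2,3) finM by (auto intro: matching_remove rainbow_remove)
  have ux: "{u, x} \<inter> \<Union>?N = {}" "c {u, x} \<notin> c ` ?N"
    using x assms(6,11) by auto
  note N1 = rainbow_matching_insert[OF N assms(9) ux]
  \<comment> \<open>The two new edges are disjoint: \<open>u\<close> and \<open>w\<close> are
    uncovered while \<open>x\<close> and \<open>y\<close> are covered, and both pairs are
    distinct.\<close>
  have wy: "{w, y} \<inter> \<Union>(insert {u, x} ?N) = {}" "c {w, y} \<notin> c ` insert {u, x} ?N"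
    using y assms(6-8,12) neq \<open>x \<noteq> y\<close> xy by auto
  note N2 = rainbow_matching_insert[OF N1(1,2) finite.insertI[OF N(3)] assms(10) wy]
  have "card M = Suc (card ?N)"
    using finM xy by (metis card.remove)
  with N1(3) N2 max show False
    by auto
qed

text \<open>Each \<open>u\<close> contributes at most 2, one for each end of \<open>e\<close>. The
  exchange property leaves room for at most two vertices that contribute 2, hence the excess 2 over
  \<open>card U\<close>.\<close>

lemma sum_new_colors_towards_edge:
  assumes "finite_simple_graph V E" "matching E M" "rainbow c M"
    and max: "\<nexists>M'. matching E M' \<and> rainbow c M' \<and> card M' = Suc (card M)"
    and "e \<in> M" "finite U" "U \<inter> \<Union>M = {}"
  shows "(\<Sum>u\<in>U. card ((\<lambda>z. c {u, z}) ` {z \<in> e. {u, z} \<in> E} - c ` M)) \<le> card U + 2"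
proof -
  let ?F = "\<lambda>u. (\<lambda>z. c {u, z}) ` {z \<in> e. {u, z} \<in> E} - c ` M"
  have "card e = 2"
    using assms(1,2,5) by (auto simp: finite_simple_graph_def matching_def)
  then obtain x y where e: "e = {x, y}" "x \<noteq> y"
    by (meson card_2_iff)
  have le2: "card (?F u) \<le> 2" for u
  proof -
    have "card (?F u) \<le> card {c {u, x}, c {u, y}}"
      by (rule card_mono) (auto simp: e)
    also have "\<dots> \<le> 2"
      by (simp add: card_insert_if)
    finally show ?thesis .
  qed
  define A where "A = {u \<in> U. card (?F u) = 2}"
  have A: "u \<in> U \<and> {u, x} \<in> E \<and> {u, y} \<in> E \<and> c {u, x} \<notin> c ` M \<and> c {u, y} \<notin> c ` M \<and>
      c {u, x} \<noteq> c {u, y}" if "u \<in> A" for u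
  proof -
    have "u \<in> U" "card (?F u) = 2"
      using that by (auto simp: A_def)
    \<comment> \<open>Taking \<open>a\<close> to be either of the two possible colors forces the
      other one into \<open>?F u\<close>, so both edges exist and their colors are new and
      distinct.\<close>
    have "\<not> ?F u \<subseteq> {a}" for a
      using \<open>card (?F u) = 2\<close> card_mono[of "{a}" "?F u"] by auto
    from this[of "c {u, x}"] this[of "c {u, y}"] \<open>u \<in> U\<close> show ?thesis
      by (auto simp: e)
  qed
  have swap: "c {u, x} = c {w, y}" if "u \<in> A" "w \<in> A" "u \<noteq> w" for u w
    using A[OF that(1)] A[OF that(2)] that(3) assms(5,7) e
    by (intro rainbow_matching_exchange[OF assms(1-3) max]) auto
  have "card A \<le> 2"
  proof (rule ccontr)
    assume "\<not> card A \<le> 2"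
    then obtain B where "B \<subseteq> A" "card B = 3"
      using obtain_subset_with_card_n[of 3 A] by auto
    then obtain u w t where "u \<in> A" "w \<in> A" "t \<in> A" "u \<noteq> w" "u \<noteq> t" "w \<noteq> t"
      by (auto simp: card_3_iff)
    \<comment> \<open>Via the third vertex,
      \<open>c {u, y} = c {t, x} = c {w, y} = c {u, x}\<close>, although \<open>u\<close> sees two
      different colors. Two vertices alone give no such chain.\<close>
    then show False
      using swap A by metis
  qed
  have "(\<Sum>u\<in>U. card (?F u)) \<le> (\<Sum>u\<in>U. 1 + of_bool (u \<in> A))"
  proof (rule sum_mono)
    fix u assume "u \<in> U"
    with le2[of u] show "card (?F u) \<le> 1 + of_bool (u \<in> A)"
      by (auto simp: A_def)
  qed
  also have "\<dots> = card U + card A"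
    using assms(6) unfolding A_def by (subst sum.distrib) (simp add: Int_def)
  finally show ?thesis
    using \<open>card A \<le> 2\<close> by linarith
qed

text \<open>An edge at \<open>u\<close> whose color is missing from \<open>M\<close> must end in
  \<open>\<Union>M\<close>, since otherwise it would extend \<open>M\<close>. The sum may count a
  color several times, which is harmless for an upper bound.\<close>

lemma color_degree_uncovered:
  assumes "finite_simple_graph V E" "matching E M" "rainbow c M"
    and max: "\<nexists>M'. matching E M' \<and> rainbow c M' \<and> card M' = Suc (card M)"
    and "u \<notin> \<Union>M"
  shows "color_degree E c u
    \<le> card M + (\<Sum>e\<in>M. card ((\<lambda>z. c {u, z}) ` {z \<in> e. {u, z} \<in> E} - c ` M))"
proof -
  let ?F = "\<lambda>e. (\<lambda>z. c {u, z}) ` {z \<in> e. {u, z} \<in> E} - c ` M"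
  have finM: "finite M"
    using assms(2) finite_simple_graph_finite_edges[OF assms(1)]
    by (auto simp: matching_def intro: finite_subset)
  have finF: "finite (?F e)" if "e \<in> M" for e
  proof -
    have "card e = 2"
      using that assms(1,2) by (auto simp: matching_def finite_simple_graph_def)
    then have "finite e"
      by (intro card_ge_0_finite) simp
    then show ?thesis
      by simp
  qed
  have "c ` {e \<in> E. u \<in> e} \<subseteq> c ` M \<union> (\<Union>e\<in>M. ?F e)"
  proof (clarify)
    fix e assume e: "e \<in> E" "u \<in> e" "c e \<notin> (\<Union>e\<in>M. ?F e)"
    obtain z where z: "e = {u, z}"
      using finite_simple_graph_edge_at[OF assms(1) e(1,2)] .
    show "c e \<in> c ` M"
    proof (rule ccontr)
      assume new: "c e \<notin> c ` M"
      \<comment> \<open>If \<open>z\<close> lay in some \<open>f \<in> M\<close>, the new color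
        \<open>c e\<close> would belong to \<open>?F f\<close>.\<close>
      have "z \<notin> \<Union>M"
        using e z new by auto
      with z assms(5) have "e \<inter> \<Union>M = {}"
        by auto
      from rainbow_matching_insert[OF assms(2,3) finM e(1) this new] max show False
        by auto
    qed
  qed
  then have "color_degree E c u \<le> card (c ` M \<union> (\<Union>e\<in>M. ?F e))"
    unfolding color_degree_def using finM finF by (intro card_mono) auto
  also have "\<dots> \<le> card (c ` M) + card (\<Union>e\<in>M. ?F e)"
    by (rule card_Un_le)
  also have "\<dots> \<le> card M + (\<Sum>e\<in>M. card (?F e))"
    using finM by (intro add_mono card_image_le card_UN_le)
  finally show ?thesis .
qed

text \<open>The uncovered vertices contribute at most \<open>2 * card M * (card V + 1)\<close>, and
  the \<open>2 * card M\<close> covered ones at most \<open>d\<close> each.\<close>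

lemma total_color_degree_le:
  assumes "finite_simple_graph V E" "matching E M" "rainbow c M"
    and max: "\<nexists>M'. matching E M' \<and> rainbow c M' \<and> card M' = Suc (card M)"
    and deg: "\<And>v. v \<in> V \<Longrightarrow> color_degree E c v \<le> d"
  shows "total_color_degree V E c \<le> 2 * card M * (card V + 1 + d)"
proof -
  define U where "U = V - \<Union>M"
  let ?F = "\<lambda>u e. (\<lambda>z. c {u, z}) ` {z \<in> e. {u, z} \<in> E} - c ` M"
  have fin: "finite V" and sub: "\<Union>M \<subseteq> V"
    using assms(1,2) by (auto simp: finite_simple_graph_def matching_def)
  have finU: "finite U" and disj: "U \<inter> \<Union>M = {}"
    using fin by (auto simp: U_def)
  have "(\<Sum>u\<in>U. color_degree E c u) \<le> (\<Sum>u\<in>U. card M + (\<Sum>e\<in>M. card (?F u e)))"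
    using color_degree_uncovered[OF assms(1-3) max] by (intro sum_mono) (auto simp: U_def)
  \<comment> \<open>Double counting: with the sum over \<open>M\<close> outermost, the bound for a
    single edge of \<open>M\<close> applies to each inner sum.\<close>
  also have "\<dots> = card U * card M + (\<Sum>e\<in>M. \<Sum>u\<in>U. card (?F u e))"
    by (simp add: sum.distrib sum.swap[of _ U])
  also have "(\<Sum>e\<in>M. \<Sum>u\<in>U. card (?F u e)) \<le> (\<Sum>e\<in>M. card U + 2)"
    using sum_new_colors_towards_edge[OF assms(1-3) max _ finU disj] by (intro sum_mono) auto
  finally have "(\<Sum>u\<in>U. color_degree E c u) \<le> 2 * card M * (card U + 1)"
    by (simp add: algebra_simps)
  also have "\<dots> \<le> 2 * card M * (card V + 1)"
    using fin by (intro mult_le_mono2 add_le_mono1 card_mono) (auto simp: U_def)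
  finally have out: "(\<Sum>u\<in>U. color_degree E c u) \<le> 2 * card M * (card V + 1)" .
  have "(\<Sum>u\<in>\<Union>M. color_degree E c u) \<le> card (\<Union>M) * d"
    using sum_bounded_above[of "\<Union>M" "color_degree E c" d] deg sub by auto
  also have "\<dots> = 2 * card M * d"
    by (simp add: card_Union_matching[OF assms(1,2)])
  finally have "(\<Sum>u\<in>\<Union>M. color_degree E c u) \<le> 2 * card M * d" .
  moreover have "total_color_degree V E c
      = (\<Sum>u\<in>U. color_degree E c u) + (\<Sum>u\<in>\<Union>M. color_degree E c u)"
    unfolding total_color_degree_def U_def using sum.subset_diff[OF sub fin] .
  ultimately show ?thesis
    using out by (simp add: algebra_simps)
qed

section \<open>The induction on the size of the matching\<close>

lemma rainbow_matching_exists: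
  assumes "finite_simple_graph V E" "card V \<ge> 3 * m\<^sup>2 + 4 * m"
    and "total_color_degree V E c \<ge> 2 * m * card V"
  shows "\<exists>M. matching E M \<and> rainbow c M \<and> card M = m"
  using assms
\<comment> \<open>The graph is generalized because one case applies the induction hypothesis after
  deleting a vertex.\<close>
proof (induction m arbitrary: V E)
  case 0
  have "matching E {} \<and> rainbow c {} \<and> card {} = 0"
    by (simp add: matching_def rainbow_def)
  then show ?case by blast
next
  case (Suc m)
  let ?n = "card V"
  \<comment> \<open>This is \<open>3 * (m + 1)\<^sup>2 + 4 * (m + 1)\<close> expanded.\<close>
  have n: "?n \<ge> 3 * m\<^sup>2 + 10 * m + 7"
    using Suc.prems(2) by (simp add: power2_eq_square algebra_simps)
  show ?case
  proof (cases "\<exists>v\<in>V. color_degree E c v > 3 * m")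
    case True
    then obtain v where v: "v \<in> V" "color_degree E c v > 3 * m"
      by blast
    let ?V = "V - {v}" and ?E = "{e \<in> E. v \<notin> e}"
    have card: "card ?V = ?n - 1"
      using v(1) by simp
    have "finite_simple_graph ?V ?E"
      using Suc.prems(1) by (auto simp: finite_simple_graph_def)
    moreover have "3 * m\<^sup>2 + 4 * m \<le> card ?V"
      using n card by linarith
    moreover have "2 * m * card ?V \<le> total_color_degree ?V ?E c"
    proof -
      \<comment> \<open>The left side equals \<open>2 * (m + 1) * (?n - 1)\<close>, so the loss from
        deleting \<open>v\<close> is covered by the drop in the required total.\<close>
      have "2 * m * card ?V + 2 * (?n - 1) \<le> 2 * Suc m * ?n"
        unfolding card by (simp add: algebra_simps diff_mult_distrib2)
      also have "\<dots> \<le> total_color_degree ?V ?E c + 2 * (?n - 1)"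
        using Suc.prems(3) total_color_degree_delete_vertex[OF Suc.prems(1) v(1), of c]
        by (rule le_trans)
      finally show ?thesis by simp
    qed
    ultimately obtain M where "matching ?E M" "rainbow c M" "card M = m"
      using Suc.IH by blast
    with rainbow_matching_extend_at_vertex[OF Suc.prems(1), of v M c] v(2) show ?thesis
      by simp
  next
    case False
    \<comment> \<open>Here the induction hypothesis is applied to the whole graph, whose total
      exceeds what size \<open>m\<close> requires.\<close>
    have "2 * m * ?n \<le> total_color_degree V E c"
      using Suc.prems(3) by simp
    moreover have "3 * m\<^sup>2 + 4 * m \<le> ?n"
      using n by linarith
    ultimately obtain M where M: "matching E M" "rainbow c M" "card M = m"
      using Suc.IH[OF Suc.prems(1)] by blast
    show ?thesis
    proof (rule ccontr)
      assume "\<not> ?thesis"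
      then have "total_color_degree V E c \<le> 2 * m * (?n + 1 + 3 * m)"
        using total_color_degree_le[OF Suc.prems(1) M(1,2), of "3 * m"] M(3) False
        by (auto simp: not_less)
      also have "\<dots> = 2 * m * ?n + 2 * m + 6 * m\<^sup>2"
        by (simp add: algebra_simps power2_eq_square)
      \<comment> \<open>What is needed is \<open>m + 3 * m\<^sup>2 < ?n\<close>; the quadratic term
        in the hypothesis on the number of vertices matches the contribution of the covered
        vertices.\<close>
      also have "\<dots> < 2 * m * ?n + 2 * ?n"
        using n by linarith
      finally show False
        using Suc.prems(3) by simp
    qed
  qed
qed

theorem theorem4:
  fixes V :: "'a set" and E :: "'a set set" and c :: "'a set \<Rightarrow> nat" and m n r :: nat
  assumes "finite_simple_graph V E"
    and "card V = n"
    and "n \<ge> 3 * m ^ 2 + 4 * m"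
    and "edge_coloring E r c"
    and "total_color_degree V E c \<ge> 2 * m * n"
  shows "\<exists>M. matching E M \<and> rainbow c M \<and> card M = m"
  using rainbow_matching_exists assms by blast

end
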